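(* Let $G=\frac{1+\sqrt5}{2}$ and let $q_{\mathrm{KL}}$ be the Komornik–Loreti constant. For any transcendental $q\in(G,q_{\mathrm{KL}})$ the following dichotomy holds: each $x\in[0,1/(q-1)]$ has either a unique expansion in base $q$ or a continuum ($2^{\aleph_0}$) of expansions in base $q$.
   Context: For $q\in(1,2)$, an expansion of $x\ge 0$ in base $q$ is a sequence $(a_n)_{n\ge1}$ with $a_n\in\{0,1\}$ such that $x=\sum_{n=1}^\infty a_nq^{-n}$; every $x\in[0,1/(q-1)]$ has at least one. The Thue–Morse sequence $\mathfrak m=(\mathfrak m_n)_{n\ge0}=0110\,1001\,1001\,0110\dots$ is the fixed point of the morphism $0\to01,\ 1\to10$ starting with $0$. The Komornik–Loreti constant $q_{\mathrm{KL}}\approx1.78723$ is the unique solution $x>1$ of $\sum_{n=1}^\infty \mathfrak m_n x^{-n}=1$. *)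

theory Defs
  imports
    "HOL-Analysis.Analysis"
    "HOL-Computational_Algebra.Polynomial"
    "HOL-Library.Equipollence"
begin

section \<open>The Thue--Morse sequence\<close>

definition tm_letter :: "nat \<Rightarrow> nat list" where
  "tm_letter c = (if c = 0 then [0, 1] else [1, 0])"

text \<open>
  Since both letters have images of length 2, the concatenation of the images of the letters of an
  infinite word \<open>w\<close> has at position \<open>n\<close> the letter number \<open>n mod 2\<close> of the image of
  \<open>w (n div 2)\<close>.
\<close>

definition tm_morphism :: "(nat \<Rightarrow> nat) \<Rightarrow> (nat \<Rightarrow> nat)" where
  "tm_morphism w = (\<lambda>n. tm_letter (w (n div 2)) ! (n mod 2))"

definition thue_morse :: "nat \<Rightarrow> nat" where
  "thue_morse = (THE w. range w \<subseteq> {0, 1} \<and> w 0 = 0 \<and> tm_morphism w = w)"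

fun tm_rec :: "nat \<Rightarrow> nat" where
  "tm_rec n = (if n = 0 then 0 else tm_letter (tm_rec (n div 2)) ! (n mod 2))"

declare tm_rec.simps [simp del]

lemma tm_letter_nth: "i < 2 \<Longrightarrow> tm_letter c ! i \<in> {0, 1}"
  by (cases i) (auto simp: tm_letter_def)

lemma tm_rec_bin: "tm_rec n \<in> {0, 1}"
  by (subst tm_rec.simps) (use tm_letter_nth[of "n mod 2" "tm_rec (n div 2)"] in auto)

lemma tm_rec_0: "tm_rec 0 = 0"
  by (subst tm_rec.simps) simp

lemma tm_rec_fix: "tm_morphism tm_rec = tm_rec"
proof
  fix n
  show "tm_morphism tm_rec n = tm_rec n"
  proof (cases "n = 0")
    case True
    then show ?thesis by (simp add: tm_morphism_def tm_rec_0 tm_letter_def)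
  next
    case False
    then show ?thesis using tm_rec.simps[of n] by (simp add: tm_morphism_def)
  qed
qed

lemma tm_fixed_point_unique:
  assumes "w 0 = 0" "tm_morphism w = w" "v 0 = 0" "tm_morphism v = v"
  shows "w = v"
proof
  fix n
  show "w n = v n"
  proof (induction n rule: less_induct)
    case (less n)
    show ?case
    proof (cases "n = 0")
      case True
      then show ?thesis using assms by simp
    next
      case False
      then have "w (n div 2) = v (n div 2)" using less by simp
      then have "tm_morphism w n = tm_morphism v n" by (simp add: tm_morphism_def)
      then show ?thesis using assms by simp
    qed
  qed
qed

lemma thue_morse_ex1: "\<exists>!w. range w \<subseteq> {0, 1} \<and> w 0 = 0 \<and> tm_morphism w = w"
proof (rule ex1I[of _ tm_rec])
  show "range tm_rec \<subseteq> {0, 1} \<and> tm_rec 0 = 0 \<and> tm_morphism tm_rec = tm_rec"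
    using tm_rec_bin tm_rec_0 tm_rec_fix by (simp add: image_subset_iff)
qed (use tm_fixed_point_unique tm_rec_0 tm_rec_fix in blast)

lemma thue_morse_props:
  "thue_morse n \<in> {0, 1}" "thue_morse 0 = 0" "tm_morphism thue_morse = thue_morse"
  using theI'[OF thue_morse_ex1] unfolding thue_morse_def[symmetric] by blast+

lemma thue_morse_even: "thue_morse (2 * n) = thue_morse n"
proof -
  have "thue_morse (2 * n) = tm_morphism thue_morse (2 * n)" by (simp add: thue_morse_props)
  also have "\<dots> = thue_morse n"
    using thue_morse_props(1)[of n] by (auto simp: tm_morphism_def tm_letter_def)
  finally show ?thesis .
qed

lemma thue_morse_odd: "thue_morse (2 * n + 1) = 1 - thue_morse n"
proof -
  have "thue_morse (2 * n + 1) = tm_morphism thue_morse (2 * n + 1)"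
    by (simp add: thue_morse_props)
  also have "\<dots> = 1 - thue_morse n"
    using thue_morse_props(1)[of n] by (auto simp: tm_morphism_def tm_letter_def)
  finally show ?thesis .
qed

section \<open>The Komornik--Loreti constant\<close>

definition komornik_loreti :: real where
  "komornik_loreti =
     (THE x. x > 1 \<and> (\<lambda>n. real (thue_morse (Suc n)) / x ^ Suc n) sums 1)"

lemma komornik_loreti_ex1:
  "\<exists>!x::real. x > 1 \<and> (\<lambda>n. real (thue_morse (Suc n)) / x ^ Suc n) sums 1"
proof -
  have tm_le: "real (thue_morse n) \<le> 1" for n using thue_morse_props(1)[of n] by auto
  have tm1: "thue_morse (Suc 0) = 1"
    using thue_morse_odd[of 0] by (simp add: thue_morse_props)
  have tm2: "thue_morse 2 = 1" using thue_morse_even[of 1] tm1 by simp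
  define g where "g z = (\<Sum>n. real (thue_morse n) * z ^ n)" for z :: real
  have summ: "summable (\<lambda>n. real (thue_morse n) * z ^ n)" if "\<bar>z\<bar> < 1" for z :: real
    by (rule summable_comparison_test[OF _ summable_geometric[of "\<bar>z\<bar>"]])
      (use that tm_le in \<open>auto simp: abs_mult power_abs intro!: mult_left_le_one_le\<close>)
  have sums_iff: "(\<lambda>n. real (thue_morse (Suc n)) / x ^ Suc n) sums 1 \<longleftrightarrow> g (1 / x) = 1"
    if "x > 1" for x :: real
  proof -
    have "(\<lambda>n. real (thue_morse n) * (1 / x) ^ n) sums g (1 / x)"
      unfolding g_def by (rule summable_sums, rule summ) (use that in auto)
    then have "(\<lambda>n. real (thue_morse (Suc n)) * (1 / x) ^ Suc n) sums g (1 / x)"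
      by (subst sums_Suc_iff) (simp add: thue_morse_props)
    then have "(\<lambda>n. real (thue_morse (Suc n)) / x ^ Suc n) sums g (1 / x)"
      by (simp add: power_one_over)
    then show ?thesis by (metis sums_unique)
  qed
  have g_strict: "g y < g z" if "0 < y" "y < z" "z < 1" for y z
  proof -
    let ?h = "\<lambda>n. real (thue_morse n) * z ^ n - real (thue_morse n) * y ^ n"
    have nn: "0 \<le> ?h n" for n
      using that by (auto intro!: mult_left_mono power_mono)
    have "sum ?h {1} \<le> suminf ?h"
      by (rule sum_le_suminf) (use that summ nn in \<open>auto intro!: summable_diff\<close>)
    also have "suminf ?h = g z - g y"
      unfolding g_def by (rule suminf_diff[symmetric]) (use that summ in auto)
    finally show ?thesis using that tm1 by simp
  qed
  have g_lo: "g (1 / 2) \<le> 1"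
  proof -
    have "(\<lambda>n. real (thue_morse n) * (1 / 2) ^ n) sums g (1 / 2)"
      unfolding g_def by (rule summable_sums, rule summ) auto
    then have "(\<lambda>n. real (thue_morse (Suc n)) * (1 / 2) ^ Suc n) sums g (1 / 2)"
      by (subst sums_Suc_iff) (simp add: thue_morse_props)
    from sums_le[OF _ this power_half_series] show ?thesis
      using tm_le by (auto intro!: mult_left_le_one_le)
  qed
  have g_hi: "1 \<le> g (9 / 10)"
  proof -
    have "(\<Sum>n\<in>{1, 2}. real (thue_morse n) * (9 / 10) ^ n) \<le> g (9 / 10)"
      unfolding g_def by (rule sum_le_suminf) (use summ[of "9/10"] in auto)
    then show ?thesis using tm1 tm2 by (simp add: power2_eq_square)
  qed
  have g_cont: "isCont g z" if "\<bar>z\<bar> < 19 / 20" for z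
    unfolding g_def
    by (rule isCont_powser[where K = "19 / 20"]) (use that summ[of "19/20"] in auto)
  have "\<exists>z\<ge>1 / 2. z \<le> 9 / 10 \<and> g z = 1"
    by (rule IVT[where f = g, OF g_lo g_hi]) (auto intro!: g_cont)
  then obtain z where z: "1 / 2 \<le> z" "z \<le> 9 / 10" "g z = 1" by blast
  show ?thesis
  proof (rule ex1I[of _ "1 / z"])
    have gt: "1 / z > 1" using z by (simp add: field_simps)
    then show "1 / z > 1 \<and> (\<lambda>n. real (thue_morse (Suc n)) / (1 / z) ^ Suc n) sums 1"
      using sums_iff[OF gt] z by simp
  next
    fix x :: real
    assume "x > 1 \<and> (\<lambda>n. real (thue_morse (Suc n)) / x ^ Suc n) sums 1"
    then have x: "x > 1" "g (1 / x) = 1" using sums_iff by auto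
    have "1 / x = z"
      using g_strict[of "1 / x" z] g_strict[of z "1 / x"] x z
      by (cases "1 / x" z rule: linorder_cases) auto
    then show "x = 1 / z" by auto
  qed
qed

section \<open>Expansions in non-integer bases\<close>

text \<open>Sequences are indexed from 0, so \<open>a n\<close> is the digit \<open>a\<^sub>n\<^sub>+\<^sub>1\<close> of the expansion.\<close>

definition expansions :: "real \<Rightarrow> real \<Rightarrow> (nat \<Rightarrow> nat) set" where
  "expansions q x = {a. range a \<subseteq> {0, 1} \<and> (\<lambda>n. real (a n) / q ^ Suc n) sums x}"

end

theory Submission
  imports Defs
begin

text \<open>
  An isolated point of the set of expansions of \<open>x\<close> has a tail that is a unique expansion. For
  \<open>q < q\<^sub>K\<^sub>L\<close> unique expansions are eventually periodic: \<open>q\<close> being smaller, all their tails stay below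
  the Thue--Morse sequence by a margin that is visible in a bounded prefix, such a sequence is
  (after a finite prefix) an image under the Thue--Morse morphism or has period at most 2, and
  passing to the preimage halves the bound. Two eventually periodic expansions of the same number
  would make \<open>q\<close> algebraic, so there is at most one isolated expansion. If there are two expansions,
  then of the two cylinders separating them one contains no isolated point; it is perfect, hence has
  the cardinality of the continuum.
\<close>

section \<open>Combinatorics of the Thue--Morse sequence\<close>

text \<open>Boolean digits turn complementation of words into negation.\<close>

definition tm :: "nat \<Rightarrow> bool" where
  "tm n \<longleftrightarrow> thue_morse n = 1"

lemma of_bool_tm: "of_bool (tm n) = real (thue_morse n)"
  using thue_morse_props(1)[of n] by (auto simp: tm_def)

lemma tm_even [simp]: "tm (2 * n) = tm n"
  by (simp add: tm_def thue_morse_even)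

lemma tm_odd [simp]: "tm (Suc (2 * n)) = (\<not> tm n)"
  using thue_morse_odd[of n] thue_morse_props(1)[of n] by (auto simp: tm_def)

lemma tm_values:
  "\<not> tm 0" "tm 1" "tm 2" "\<not> tm 3" "tm 4" "\<not> tm 5" "\<not> tm 6"
proof -
  show 0: "\<not> tm 0" by (simp add: tm_def thue_morse_props)
  show 1: "tm 1" using tm_odd[of 0] 0 by simp
  show 2: "tm 2" using tm_even[of 1] 1 by simp
  show 3: "\<not> tm 3" using tm_odd[of 1] 1 by (simp add: numeral_eq_Suc)
  show "tm 4" using tm_even[of 2] 2 by simp
  show "\<not> tm 5" using tm_odd[of 2] 2 by simp
  show "\<not> tm 6" using tm_even[of 3] 3 by simp
qed

text \<open>Any three consecutive positions contain a block \<open>2 * l\<close>,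
  \<open>2 * l + 1\<close>, whose two letters differ.\<close>

lemma tm_no_cube: "\<not> (tm n \<and> tm (n + 1) \<and> tm (n + 2))"
proof (cases "even n")
  case True
  then obtain l where "n = 2 * l" by blast
  then show ?thesis by simp
next
  case False
  then obtain l where "n = 2 * l + 1" using oddE by blast
  then show ?thesis using tm_odd[of "Suc l"] tm_even[of "Suc l"] by simp
qed

text \<open>Descent along the morphism. The letters 11 at \<open>k + 1\<close>, \<open>k + 2\<close>
  cannot form a block, so \<open>k\<close> is even. If \<open>j\<close> is odd, the letter at
  \<open>j\<close> is determined by its block partner at \<open>j - 1\<close>; if \<open>j\<close>
  is even, halving all positions gives a smaller counterexample.\<close>

lemma tm_shift_not_greater:
  assumes "\<And>i. 1 \<le> i \<Longrightarrow> i < j \<Longrightarrow> tm (k + i) = tm i" "tm (k + j)" "\<not> tm j" "1 \<le> j"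
  shows False
  using assms
proof (induction j arbitrary: k rule: less_induct)
  case (less j)
  have "j \<noteq> 1" "j \<noteq> 2" using less.prems(3) tm_values by auto
  with less.prems(4) have j3: "j \<ge> 3" by linarith
  have k12: "tm (k + 1)" "tm (k + 2)"
    using less.prems(1)[of 1] less.prems(1)[of 2] tm_values j3 by auto
  have "j \<noteq> 3" using tm_no_cube[of "k + 1"] k12 less.prems(2) by (auto simp: numeral_eq_Suc)
  with j3 have j4: "j \<ge> 4" by linarith
  have "even k"
  proof (rule ccontr)
    assume "odd k"
    then obtain l where "k = 2 * l + 1" using oddE by blast
    then show False using k12 tm_odd[of "Suc l"] tm_even[of "Suc l"] by simp
  qed
  then obtain l where l: "k = 2 * l" by blast
  show False
  proof (cases "even j")
    case True
    then obtain h where h: "j = 2 * h" by blast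
    show False
    proof (rule less.IH[of h l])
      fix i assume "1 \<le> i" "i < h"
      then show "tm (l + i) = tm i"
        using less.prems(1)[of "2 * i"] h l tm_even[of "l + i"] by simp
    next
      show "tm (l + h)" using less.prems(2) h l tm_even[of "l + h"] by simp
    qed (use h j4 less.prems(3) in auto)
  next
    case False
    then obtain h where h: "j = 2 * h + 1" using oddE by blast
    have "tm (l + h) = tm h"
      using less.prems(1)[of "2 * h"] h l j4 tm_even[of "l + h"] by simp
    then show False using less.prems(2,3) h l tm_odd[of "l + h"] by simp
  qed
qed

section \<open>Sequences lexicographically below Thue-Morse\<close>

text \<open>
  Every tail of \<open>A\<close>, complemented if it starts with the digit 1, is lexicographically smaller than
  the Thue--Morse sequence, and the difference shows up within the first \<open>N + 1\<close> digits.
\<close>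

definition below_tm :: "nat \<Rightarrow> (nat \<Rightarrow> bool) \<Rightarrow> bool" where
  "below_tm N A \<longleftrightarrow>
     (\<forall>n. \<exists>j\<le>N. tm j \<and> A (n + j) = A n \<and> (\<forall>i<j. A (n + i) = (A n \<noteq> tm i)))"

definition ev_periodic :: "(nat \<Rightarrow> 'a) \<Rightarrow> bool" where
  "ev_periodic A \<longleftrightarrow> (\<exists>s>0. \<exists>r. \<forall>n\<ge>r. A (n + s) = A n)"

lemma ev_periodicI: "s > 0 \<Longrightarrow> (\<And>n. n \<ge> r \<Longrightarrow> A (n + s) = A n) \<Longrightarrow> ev_periodic A"
  unfolding ev_periodic_def by blast

text \<open>Both sequences consist of blocks 01 and 10, so agreement at the first place of a block
  forces agreement at the second. The first difference therefore has even index and can be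
  halved.\<close>

lemma below_tm_desubstitute:
  assumes "below_tm N A" "\<And>i. A (k + 2 * i + 1) = (\<not> A (k + 2 * i))"
  shows "below_tm (N div 2) (\<lambda>i. A (k + 2 * i))"
  unfolding below_tm_def
proof
  fix n
  obtain j where j: "j \<le> N" "tm j" "A (k + 2 * n + j) = A (k + 2 * n)"
    "\<And>i. i < j \<Longrightarrow> A (k + 2 * n + i) = (A (k + 2 * n) \<noteq> tm i)"
    using assms(1) unfolding below_tm_def by metis
  have "even j"
  proof (rule ccontr)
    assume "odd j"
    then obtain h where h: "j = 2 * h + 1" using oddE by blast
    have "A (k + 2 * n + 2 * h + 1) = (\<not> A (k + 2 * n + 2 * h))"
      using assms(2)[of "n + h"] by (simp add: algebra_simps)
    then show False using j(2,3) j(4)[of "2 * h"] h by auto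
  qed
  then obtain h where h: "j = 2 * h" by blast
  show "\<exists>j\<le>N div 2. tm j \<and> A (k + 2 * (n + j)) = A (k + 2 * n) \<and>
      (\<forall>i<j. A (k + 2 * (n + i)) = (A (k + 2 * n) \<noteq> tm i))"
  proof (intro exI conjI allI impI)
    show "h \<le> N div 2" using h j(1) by simp
    show "tm h" using h j(2) by simp
    show "A (k + 2 * (n + h)) = A (k + 2 * n)" using j(3) h by (simp add: algebra_simps)
    show "A (k + 2 * (n + i)) = (A (k + 2 * n) \<noteq> tm i)" if "i < h" for i
    proof -
      have "A (k + 2 * n + 2 * i) = (A (k + 2 * n) \<noteq> tm i)"
        using j(4)[of "2 * i"] that h by simp
      then show ?thesis by (simp add: algebra_simps)
    qed
  qed
qed

text \<open>
  A first failure of the block structure creates one of the words 0111, 011011, 0110101 (or its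
  complement), all of which exceed the Thue--Morse sequence 0110100...
\<close>

lemma below_tm_parse:
  assumes below: "below_tm N A" and k: "A (k + 1) = (\<not> A k)" "A (k + 2) = A (k + 1)"
  shows "A (k + 2 * i + 1) = (\<not> A (k + 2 * i))"
proof (induction i rule: less_induct)
  case (less l)
  have len: "\<exists>j. tm j \<and> A (n + j) = A n \<and> (\<forall>i<j. A (n + i) = (A n \<noteq> tm i))" for n
    using below unfolding below_tm_def by metis
  have no_cube: "\<not> (A (n + 1) = (\<not> A n) \<and> A (n + 2) = (\<not> A n) \<and> A (n + 3) = (\<not> A n))" for n
  proof
    assume h: "A (n + 1) = (\<not> A n) \<and> A (n + 2) = (\<not> A n) \<and> A (n + 3) = (\<not> A n)"
    obtain j where j: "tm j" "A (n + j) = A n" "\<And>i. i < j \<Longrightarrow> A (n + i) = (A n \<noteq> tm i)"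
      using len[of n] by blast
    have "j \<noteq> 0" using j(1) tm_values(1) by metis
    then have "j \<notin> {0, 1, 2, 3}" using j(1,2) h tm_values by auto
    then have "j > 3" by auto
    with j(3)[of 3] h tm_values show False by auto
  qed
  show ?case
  proof (rule ccontr)
    assume "\<not> ?thesis"
    then have dbl: "A (k + 2 * l + 1) = A (k + 2 * l)" by simp
    define f where "f = A (k + 2 * l)"
    have "l \<noteq> 0" using dbl k by (cases l) auto
    then obtain l' where l': "l = Suc l'" using not0_implies_Suc by blast
    have last: "A (k + 2 * l') = f"
    proof (rule ccontr)
      assume "A (k + 2 * l') \<noteq> f"
      then show False
        using no_cube[of "k + 2 * l'"] less.IH[of l'] dbl l' unfolding f_def
        by (simp add: numeral_eq_Suc)
    qed
    have l'0: "l' \<noteq> 0"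
    proof
      assume "l' = 0"
      then show False using last k dbl l' unfolding f_def by auto
    qed
    \<comment> \<open>The word to be found starts at the last block before \<open>l'\<close> that
      opens with the opposite of \<open>f\<close>. One exists since, by \<open>k\<close>, blocks 0
      and 1 open with different digits.\<close>
    define I where "I = {i. i < l' \<and> A (k + 2 * i) = (\<not> f)}"
    have fin: "finite I" unfolding I_def by simp
    have "0 \<in> I \<or> 1 \<in> I"
    proof (cases "l' = 1")
      case True
      then show ?thesis using last k l'0 unfolding I_def by auto
    next
      case False
      then show ?thesis using k l'0 unfolding I_def by auto
    qed
    then have ne: "I \<noteq> {}" by auto
    define i where "i = Max I"
    have i: "i < l'" "A (k + 2 * i) = (\<not> f)"
      using Max_in[OF fin ne] unfolding i_def[symmetric] by (simp_all add: I_def)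
    have run: "A (k + 2 * h) = f" if "i < h" "h \<le> l" for h
    proof (cases "h < l'")
      case True
      have "h \<notin> I" using Max_ge[OF fin, of h] that unfolding i_def[symmetric] by auto
      then show ?thesis using True unfolding I_def by auto
    next
      case False
      then have "h = l' \<or> h = l" using that l' by auto
      then show ?thesis using last f_def by auto
    qed
    define n where "n = k + 2 * i"
    \<comment> \<open>With 1 for \<open>f\<close>, block \<open>i\<close> is 01, the next is 10 and
      a third opens with 1. A difference from Thue-Morse within 0110100 is impossible at these
      digits, so 00 has to follow.\<close>
    have digits: "A n = (\<not> f)" "A (n + 1) = f" "A (n + 2) = f" "A (n + 3) = (\<not> f)" "A (n + 4) = f"
      using i less.IH[of i] less.IH[of "i + 1"] run[of "i + 1"] run[of "i + 2"] l'
      unfolding n_def by (auto simp: algebra_simps numeral_eq_Suc)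
    obtain j where j: "tm j" "A (n + j) = A n" "\<And>i. i < j \<Longrightarrow> A (n + i) = (A n \<noteq> tm i)"
      using len[of n] by blast
    have "j \<noteq> 0" using j(1) tm_values(1) by metis
    then have "j \<notin> {0, 1, 2, 3, 4, 5, 6}" using j(1,2) digits tm_values by auto
    then have j6: "j > 6" by auto
    have 5: "A (n + 5) = (\<not> f)" and 6: "A (n + 6) = (\<not> f)"
      using j(3)[of 5] j(3)[of 6] digits(1) tm_values j6 by auto
    \<comment> \<open>If the doubled block comes third, the word is 011011; otherwise block
      \<open>i + 3\<close> opens with \<open>f\<close> and the word is 0110101.\<close>
    show False
    proof (cases "i + 2 = l")
      case True
      have "k + 2 * l + 1 = n + 5" "k + 2 * l = n + 4" unfolding n_def True[symmetric] by simp_all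
      with dbl have "A (n + 5) = A (n + 4)" by metis
      with 5 digits(5) show False by simp
    next
      case False
      then have "i + 3 \<le> l" using i(1) l' by simp
      then have "A (n + 6) = f" using run[of "i + 3"] unfolding n_def by (simp add: algebra_simps)
      with 6 show False by simp
    qed
  qed
qed

text \<open>Descent on \<open>N\<close>. The sequence is constant, or alternates from some place on,
  or a digit change followed by a repetition fixes the block structure. In the last case the
  preimage has a smaller bound, and its period gets doubled.\<close>

lemma below_tm_imp_ev_periodic:
  "below_tm N A \<Longrightarrow> ev_periodic A"
proof (induction N arbitrary: A rule: less_induct)
  case (less N)
  consider (const) "\<And>k. A (k + 1) = A k" | (change) k where "A (k + 1) = (\<not> A k)" by auto
  then show ?case
  proof cases
    case const
    then show ?thesis by (intro ev_periodicI[of 1 0]) auto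
  next
    case (change k)
    show ?thesis
    proof (cases "\<exists>k. A (k + 1) = (\<not> A k) \<and> A (k + 2) = A (k + 1)")
      case False
      have alt: "A (k + d + 1) = (\<not> A (k + d))" for d
      proof (induction d)
        case 0 then show ?case using change by simp
      next
        case (Suc d)
        have "A (k + d + 2) \<noteq> A (k + d + 1)" using False Suc by blast
        then show ?case by simp
      qed
      show ?thesis
      proof (rule ev_periodicI[of 2 k])
        fix n assume "n \<ge> k"
        then obtain d where "n = k + d" using le_Suc_ex by blast
        then show "A (n + 2) = A n" using alt[of d] alt[of "Suc d"] by simp
      qed simp
    next
      case True
      then obtain k where k: "A (k + 1) = (\<not> A k)" "A (k + 2) = A (k + 1)" by blast
      note parse = below_tm_parse[OF less.prems k]
      \<comment> \<open>\<open>tm 0\<close> is false, so the bound 0 is unattainable and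
        \<open>N div 2\<close> is strictly smaller.\<close>
      have "N \<noteq> 0" using less.prems tm_values(1) unfolding below_tm_def by (metis le_zero_eq)
      then have "ev_periodic (\<lambda>i. A (k + 2 * i))"
        using less.IH[OF _ below_tm_desubstitute[OF less.prems parse]] by simp
      then obtain s r where sr: "s > 0" "\<And>n. n \<ge> r \<Longrightarrow> A (k + 2 * (n + s)) = A (k + 2 * n)"
        unfolding ev_periodic_def by blast
      show ?thesis
      proof (rule ev_periodicI[of "2 * s" "k + 2 * r"])
        fix n assume n: "n \<ge> k + 2 * r"
        define i where "i = (n - k) div 2"
        have ir: "i \<ge> r" using n unfolding i_def by linarith
        have "n = k + 2 * i \<or> n = k + 2 * i + 1" using n unfolding i_def by presburger
        then show "A (n + 2 * s) = A n"
        proof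
          assume "n = k + 2 * i"
          then show ?thesis using sr(2)[OF ir] by (simp add: algebra_simps)
        next
          assume "n = k + 2 * i + 1"
          then show ?thesis using sr(2)[OF ir] parse[of i] parse[of "i + s"]
            by (simp add: algebra_simps)
        qed
      qed (use sr in simp)
    qed
  qed
qed

section \<open>Values of digit sequences\<close>

text \<open>
  The digit \<open>A n\<close> has weight \<open>x ^ n\<close>, so \<open>digit_sum (1 / q)\<close> is \<open>q\<close> times the value of the
  expansion. The weight 1 goes to the digit 0 with which the Thue--Morse sequence starts.
\<close>

definition digit_sum :: "real \<Rightarrow> (nat \<Rightarrow> bool) \<Rightarrow> real" where
  "digit_sum x A = (\<Sum>n. of_bool (A n) * x ^ n)"

context
  fixes x :: real
  assumes x: "0 < x" "x < 1"
begin

lemma summable_digits: "summable (\<lambda>n. of_bool (A n) * x ^ n)"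
  by (rule summable_comparison_test[OF _ summable_geometric[of x]]) (use x in auto)

lemma digit_sum_sums: "(\<lambda>n. of_bool (A n) * x ^ n) sums digit_sum x A"
  unfolding digit_sum_def by (rule summable_sums[OF summable_digits])

lemma digit_sum_split:
  "digit_sum x A = (\<Sum>i<n. of_bool (A i) * x ^ i) + x ^ n * digit_sum x (\<lambda>i. A (n + i))"
proof -
  have "digit_sum x A = (\<Sum>i. of_bool (A (i + n)) * x ^ (i + n)) + (\<Sum>i<n. of_bool (A i) * x ^ i)"
    unfolding digit_sum_def by (rule suminf_split_initial_segment[OF summable_digits])
  also have "(\<Sum>i. of_bool (A (i + n)) * x ^ (i + n)) =
      (\<Sum>i. x ^ n * (of_bool (A (n + i)) * x ^ i))"
    by (simp add: power_add ac_simps)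
  also have "\<dots> = x ^ n * digit_sum x (\<lambda>i. A (n + i))"
    unfolding digit_sum_def by (rule suminf_mult[OF summable_digits])
  finally show ?thesis by simp
qed

lemma digit_sum_Suc: "digit_sum x A = of_bool (A 0) + x * digit_sum x (\<lambda>i. A (Suc i))"
  using digit_sum_split[of A 1] by simp

lemma digit_sum_nonneg: "0 \<le> digit_sum x A"
  unfolding digit_sum_def by (rule suminf_nonneg[OF summable_digits]) (use x in auto)

lemma partial_le_digit_sum: "(\<Sum>i<n. of_bool (A i) * x ^ i) \<le> digit_sum x A"
  using digit_sum_split[of A n] digit_sum_nonneg[of "\<lambda>i. A (n + i)"] x by simp

lemma digit_sum_compl: "digit_sum x (\<lambda>i. \<not> A i) = 1 / (1 - x) - digit_sum x A"
proof -
  have "(\<lambda>n. x ^ n - of_bool (A n) * x ^ n) sums (1 / (1 - x) - digit_sum x A)"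
    by (intro sums_diff geometric_sums digit_sum_sums) (use x in auto)
  also have "(\<lambda>n. x ^ n - of_bool (A n) * x ^ n) = (\<lambda>n. of_bool (\<not> A n) * x ^ n)"
    by auto
  finally show ?thesis using digit_sum_sums sums_unique2 by blast
qed

lemma digit_sum_le: "digit_sum x A \<le> 1 / (1 - x)"
  using digit_sum_compl[of A] digit_sum_nonneg[of "\<lambda>i. \<not> A i"] by simp

lemma exists_digits:
  assumes "1 / 2 \<le> x" "0 \<le> y" "y \<le> 1 / (1 - x)"
  shows "\<exists>A. digit_sum x A = y"
proof -
  \<comment> \<open>Greedy algorithm: \<open>r n\<close> is the remainder after \<open>n\<close>
    digits divided by \<open>x ^ n\<close>; the next digit is 1 exactly if \<open>r n\<close> is at
    least 1.\<close>
  define r where "r = rec_nat y (\<lambda>_ r. (r - of_bool (r \<ge> 1)) / x)"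
  have r0: "r 0 = y" and rS: "r (Suc n) = (r n - of_bool (r n \<ge> 1)) / x" for n
    by (simp_all add: r_def)
  have bd: "0 \<le> r n \<and> r n \<le> 1 / (1 - x)" for n
  proof (induction n)
    case 0
    then show ?case using assms r0 by simp
  next
    case (Suc n)
    show ?case
    proof (cases "r n \<ge> 1")
      case True
      have "(r n - 1) / x \<le> (1 / (1 - x) - 1) / x"
        using Suc x by (intro divide_right_mono) auto
      also have "\<dots> = 1 / (1 - x)" using x by (simp add: field_simps)
      finally show ?thesis using True x rS by simp
    next
      case False
      have "r n / x \<le> 1 / x" using False x by (intro divide_right_mono) auto
      \<comment> \<open>The bound \<open>1 / 2 \<le> x\<close> keeps the remainder in range after a
        digit 0.\<close>
      also have "\<dots> \<le> 1 / (1 - x)" using x assms by (intro divide_left_mono) auto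
      finally show ?thesis using False Suc x rS by simp
    qed
  qed
  have part: "(\<Sum>i<n. of_bool (r i \<ge> 1) * x ^ i) = y - x ^ n * r n" for n
  proof (induction n)
    case 0
    then show ?case using r0 by simp
  next
    case (Suc n)
    have "x ^ Suc n * r (Suc n) = x ^ n * r n - of_bool (r n \<ge> 1) * x ^ n"
      using x by (simp add: rS field_simps)
    then show ?case unfolding sum.lessThan_Suc Suc.IH by simp
  qed
  have "(\<lambda>n. x ^ n * r n) \<longlonglongrightarrow> 0"
  proof (rule tendsto_sandwich[of "\<lambda>_. 0" _ _ "\<lambda>n. x ^ n * (1 / (1 - x))"])
    show "(\<lambda>n. x ^ n * (1 / (1 - x))) \<longlonglongrightarrow> 0"
      by (intro tendsto_mult_left_zero LIMSEQ_realpow_zero) (use x in auto)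
    show "\<forall>\<^sub>F n in sequentially. x ^ n * r n \<le> x ^ n * (1 / (1 - x))"
      using bd x by (intro always_eventually allI mult_left_mono) auto
  qed (use bd x in auto)
  then have "(\<lambda>n. y - x ^ n * r n) \<longlonglongrightarrow> y - 0" by (intro tendsto_diff tendsto_const)
  then have "(\<lambda>n. of_bool (r n \<ge> 1) * x ^ n) sums y"
    unfolding sums_def part by simp
  then have "digit_sum x (\<lambda>n. r n \<ge> 1) = y" by (rule sums_unique2[OF digit_sum_sums])
  then show ?thesis by blast
qed

text \<open>
  This is the converse direction of Parry's criterion, for the expansion \<open>tm\<close> of 1: the excess over
  1 of a tail following a digit 0 is at most \<open>x\<close> times the excess of another such tail.
\<close>

lemma digit_sum_tm_tail_le:
  assumes one: "digit_sum x tm = 1" and k: "\<not> tm k"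
  shows "digit_sum x (\<lambda>i. tm (k + i)) \<le> 1"
proof -
  define C where "C = 1 / (1 - x)"
  have C: "C \<ge> 0" unfolding C_def using x by simp
  \<comment> \<open>Starting from the trivial bound \<open>C\<close>, each step of the comparison
    gains a factor \<open>x\<close>; then \<open>r\<close> tends to infinity.\<close>
  have bound: "digit_sum x (\<lambda>i. tm (k + i)) - 1 \<le> x ^ r * C" if "\<not> tm k" for r k
    using that
  proof (induction r arbitrary: k)
    case 0
    then show ?case using digit_sum_le[of "\<lambda>i. tm (k + i)"] unfolding C_def by simp
  next
    case (Suc r)
    show ?case
    proof (cases "\<forall>i. tm (k + i) = tm i")
      case True
      then show ?thesis using one x C by simp
    next
      case False
      then obtain j where j: "tm (k + j) \<noteq> tm j" and lt: "\<And>i. i < j \<Longrightarrow> tm (k + i) = tm i"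
        using exists_least_iff[of "\<lambda>i. tm (k + i) \<noteq> tm i"] by blast
      have j1: "j \<ge> 1" using j Suc.prems tm_values(1) by (cases j) auto
      \<comment> \<open>A rise at \<open>j\<close> is ruled out, so \<open>k + j\<close> carries a 0
        again and the induction hypothesis applies there.\<close>
      have tmj: "tm j" "\<not> tm (k + j)"
        using tm_shift_not_greater[of j k] lt j j1 by auto
      have "(\<Sum>i<j. of_bool (tm (k + i)) * x ^ i) = (\<Sum>i<j. of_bool (tm i) * x ^ i)"
        using lt by (intro sum.cong) auto
      \<comment> \<open>The first \<open>j\<close> digits of \<open>tm\<close> together with the 1
        at \<open>j\<close> weigh at most 1.\<close>
      also have "\<dots> \<le> 1 - x ^ j"
        using partial_le_digit_sum[of tm "Suc j"] tmj(1) one by simp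
      finally have "digit_sum x (\<lambda>i. tm (k + i)) - 1 \<le>
          x ^ j * (digit_sum x (\<lambda>i. tm (k + j + i)) - 1)"
        using digit_sum_split[of "\<lambda>i. tm (k + i)" j] by (simp add: algebra_simps)
      also have "\<dots> \<le> x ^ j * (x ^ r * C)"
        using Suc.IH[OF tmj(2)] x by (intro mult_left_mono) auto
      also have "\<dots> \<le> x ^ 1 * (x ^ r * C)"
        using x C j1 by (intro mult_right_mono power_decreasing) auto
      finally show ?thesis by simp
    qed
  qed
  have "(\<lambda>r. x ^ r * C) \<longlonglongrightarrow> 0"
    by (intro tendsto_mult_left_zero LIMSEQ_realpow_zero) (use x in auto)
  from LIMSEQ_le_const[OF this, of "digit_sum x (\<lambda>i. tm (k + i)) - 1"] bound[OF k]
  show ?thesis by auto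
qed

end

section \<open>Comparison with the Komornik-Loreti base\<close>

lemma digit_sum_komornik_loreti:
  "komornik_loreti > 1" "digit_sum (1 / komornik_loreti) tm = 1"
proof -
  let ?p = komornik_loreti
  have p: "?p > 1" and sums: "(\<lambda>n. real (thue_morse (Suc n)) / ?p ^ Suc n) sums 1"
    using theI'[OF komornik_loreti_ex1] unfolding komornik_loreti_def[symmetric] by auto
  show "?p > 1" by (rule p)
  have "(\<lambda>n. real (thue_morse (Suc n)) * (1 / ?p) ^ Suc n) sums 1"
    using sums by (simp add: power_one_over)
  then have "(\<lambda>n. of_bool (tm n) * (1 / ?p) ^ n) sums 1"
    by (subst (asm) sums_Suc_iff) (simp add: of_bool_tm thue_morse_props)
  then show "digit_sum (1 / ?p) tm = 1"
    using digit_sum_sums[of "1 / ?p" tm] p sums_unique2 by fastforce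
qed

text \<open>At \<open>1 / komornik_loreti\<close> the sequence \<open>tm\<close> weighs exactly 1,
  so at the larger \<open>1 / q\<close> finitely many of its digits weigh more than 1 and
  \<open>A\<close> leaves \<open>tm\<close> within them. It cannot go up there: a digit 1 weighs no
  less than the tail of \<open>tm\<close> starting at a 0.\<close>

lemma tm_lex_less_of_digit_sum_less:
  assumes "1 < q" "q < komornik_loreti"
  obtains N where
    "\<And>A. digit_sum (1 / q) A < 1 \<Longrightarrow> \<exists>j\<le>N. tm j \<and> \<not> A j \<and> (\<forall>i<j. A i = tm i)"
proof -
  define p where "p = komornik_loreti"
  define x where "x = 1 / p"
  define y where "y = 1 / q"
  have p: "1 < p" "q < p" using assms unfolding p_def by auto
  have x: "0 < x" "x < 1" using p unfolding x_def by auto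
  have y: "0 < y" "y < 1" using assms unfolding y_def by auto
  have xy: "x < y" unfolding x_def y_def using assms p by (simp add: frac_less2)
  have one: "digit_sum x tm = 1"
    unfolding x_def p_def by (rule digit_sum_komornik_loreti)
  have le: "of_bool b * x ^ i \<le> of_bool b * y ^ i" for b i
    using x xy by (intro mult_left_mono power_mono) auto
  have "1 < digit_sum y tm"
  proof -
    \<comment> \<open>The index 1, where \<open>tm\<close> is true, makes the comparison
      strict.\<close>
    have "(\<Sum>n\<in>{1}. of_bool (tm n) * y ^ n - of_bool (tm n) * x ^ n) \<le>
        (\<Sum>n. of_bool (tm n) * y ^ n - of_bool (tm n) * x ^ n)"
      by (rule sum_le_suminf) (use x y le in \<open>auto intro!: summable_diff summable_digits\<close>)
    also have "\<dots> = digit_sum y tm - digit_sum x tm"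
      unfolding digit_sum_def
      by (rule suminf_diff[symmetric]) (use x y in \<open>auto intro!: summable_digits\<close>)
    finally show ?thesis using xy one tm_values(2) by simp
  qed
  moreover have "(\<lambda>n. \<Sum>i<n. of_bool (tm i) * y ^ i) \<longlonglongrightarrow> digit_sum y tm"
    using digit_sum_sums[OF y] unfolding sums_def .
  ultimately have "\<forall>\<^sub>F n in sequentially. 1 < (\<Sum>i<n. of_bool (tm i) * y ^ i)"
    by (rule order_tendstoD(1)[rotated])
  then obtain N where N: "1 < (\<Sum>i<N. of_bool (tm i) * y ^ i)"
    using eventually_happens'[OF sequentially_bot] by blast
  show ?thesis
  proof (rule that[of N])
    fix A assume A: "digit_sum (1 / q) A < 1"
    have "\<exists>i<N. A i \<noteq> tm i"
    proof (rule ccontr)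
      assume "\<nexists>i. i < N \<and> A i \<noteq> tm i"
      then have "(\<Sum>i<N. of_bool (A i) * y ^ i) = (\<Sum>i<N. of_bool (tm i) * y ^ i)"
        by (intro sum.cong) auto
      then show False using N A partial_le_digit_sum[OF y, of A N] unfolding y_def by simp
    qed
    then obtain i0 where i0: "i0 < N" "A i0 \<noteq> tm i0" by blast
    then obtain j where j: "A j \<noteq> tm j" and lt: "\<And>i. i < j \<Longrightarrow> A i = tm i"
      using exists_least_iff[of "\<lambda>i. A i \<noteq> tm i"] by blast
    have jN: "j \<le> N" using i0 lt by (meson leI less_imp_le order_trans)
    have "tm j"
    proof (rule ccontr)
      assume ntm: "\<not> tm j"
      have "1 = (\<Sum>i<j. of_bool (tm i) * x ^ i) + x ^ j * digit_sum x (\<lambda>i. tm (j + i))"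
        using digit_sum_split[OF x, of tm j] one by simp
      \<comment> \<open>The tail of \<open>tm\<close> is replaced by its bound 1, which is the digit
        of \<open>A\<close> at \<open>j\<close>, and the weights grow from \<open>x\<close> to
        \<open>y\<close>.\<close>
      also have "\<dots> \<le> (\<Sum>i<j. of_bool (tm i) * y ^ i) + y ^ j * 1"
        by (intro add_mono sum_mono le mult_mono power_mono digit_sum_tm_tail_le[OF x one ntm]
            digit_sum_nonneg[OF x]) (use x xy in auto)
      also have "(\<Sum>i<j. of_bool (tm i) * y ^ i) = (\<Sum>i<j. of_bool (A i) * y ^ i)"
        using lt by (intro sum.cong) auto
      also have "\<dots> + y ^ j * 1 = (\<Sum>i<Suc j. of_bool (A i) * y ^ i)"
        using j ntm by simp
      also have "\<dots> \<le> digit_sum y A" by (rule partial_le_digit_sum[OF y])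
      finally show False using A unfolding y_def by simp
    qed
    then show "\<exists>j\<le>N. tm j \<and> \<not> A j \<and> (\<forall>i<j. A i = tm i)" using j jN lt by blast
  qed
qed

section \<open>Unique expansions\<close>

definition univoque :: "real \<Rightarrow> (nat \<Rightarrow> bool) \<Rightarrow> bool" where
  "univoque x A \<longleftrightarrow> (\<forall>B. digit_sum x B = digit_sum x A \<longrightarrow> B = A)"

context
  fixes x :: real
  assumes x: "1 / 2 \<le> x" "x < 1"
begin

lemma x_bounds: "0 < x" "x < 1"
  using x by auto

lemma univoque_shift:
  assumes "univoque x A"
  shows "univoque x (\<lambda>i. A (n + i))"
  unfolding univoque_def
proof (intro allI impI)
  fix B assume B: "digit_sum x B = digit_sum x (\<lambda>i. A (n + i))"
  define D where "D i = (if i < n then A i else B (i - n))" for i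
  have "digit_sum x D = digit_sum x A"
    using digit_sum_split[OF x_bounds, of D n] digit_sum_split[OF x_bounds, of A n] B
    by (simp add: D_def)
  then have "D = A" using assms unfolding univoque_def by blast
  then have "D (n + i) = A (n + i)" for i by simp
  then show "B = (\<lambda>i. A (n + i))" unfolding D_def by auto
qed

lemma univoque_compl:
  assumes "univoque x A"
  shows "univoque x (\<lambda>i. \<not> A i)"
  unfolding univoque_def
proof (intro allI impI)
  fix B assume "digit_sum x B = digit_sum x (\<lambda>i. \<not> A i)"
  then have "digit_sum x (\<lambda>i. \<not> B i) = digit_sum x A"
    by (simp add: digit_sum_compl[OF x_bounds])
  then have "(\<lambda>i. \<not> B i) = A" using assms unfolding univoque_def by blast
  then show "B = (\<lambda>i. \<not> A i)" by auto
qed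

text \<open>Otherwise the leading digit 0 could be replaced by 1.\<close>

lemma univoque_digit_sum_less:
  assumes "univoque x A" "\<not> A 0"
  shows "digit_sum x A < 1"
proof (rule ccontr)
  assume "\<not> digit_sum x A < 1"
  \<comment> \<open>What the remaining digits must represent once the leading digit is 1.\<close>
  define y where "y = (digit_sum x A - 1) / x"
  have "x * digit_sum x (\<lambda>i. A (Suc i)) \<le> x * (1 / (1 - x))"
    using x by (intro mult_left_mono digit_sum_le[OF x_bounds]) auto
  then have "digit_sum x A \<le> x / (1 - x)"
    using digit_sum_Suc[OF x_bounds, of A] assms(2) by simp
  then have "y \<le> (x / (1 - x)) / x"
    unfolding y_def using x by (intro divide_right_mono) auto
  also have "\<dots> = 1 / (1 - x)" using x by simp
  finally have "y \<le> 1 / (1 - x)" .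
  moreover have "0 \<le> y" using \<open>\<not> digit_sum x A < 1\<close> x unfolding y_def by simp
  ultimately obtain B where B: "digit_sum x B = y"
    using exists_digits[OF x_bounds x(1)] by blast
  have "digit_sum x (case_nat True B) = digit_sum x A"
    using digit_sum_Suc[OF x_bounds, of "case_nat True B"] B x unfolding y_def by simp
  then have "case_nat True B = A" using assms(1) unfolding univoque_def by blast
  then show False using assms(2) by auto
qed

text \<open>Tails and complements of univoque sequences are univoque, so each tail, complemented if
  it begins with 1, weighs less than 1. A single \<open>N\<close>, depending only on
  \<open>x\<close>, serves all tails.\<close>

lemma univoque_imp_ev_periodic:
  assumes A: "univoque x A" and "1 / komornik_loreti < x"
  shows "ev_periodic A"
proof -
  have "1 < 1 / x" using x by simp
  moreover have "1 / x < komornik_loreti"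
    using assms(2) x digit_sum_komornik_loreti(1) by (simp add: divide_less_eq mult.commute)
  ultimately obtain N where N: "\<And>A. digit_sum (1 / (1 / x)) A < 1 \<Longrightarrow>
      \<exists>j\<le>N. tm j \<and> \<not> A j \<and> (\<forall>i<j. A i = tm i)"
    by (rule tm_lex_less_of_digit_sum_less[of "1 / x"]) blast
  have N': "\<exists>j\<le>N. tm j \<and> \<not> B j \<and> (\<forall>i<j. B i = tm i)" if "univoque x B" "\<not> B 0" for B
    using N[of B] univoque_digit_sum_less[OF that] by simp
  have "below_tm N A"
    unfolding below_tm_def
  proof
    fix n
    show "\<exists>j\<le>N. tm j \<and> A (n + j) = A n \<and> (\<forall>i<j. A (n + i) = (A n \<noteq> tm i))"
    proof (cases "A n")
      case True
      then show ?thesis using N'[OF univoque_compl[OF univoque_shift[OF A, of n]]] by auto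
    next
      case False
      then show ?thesis using N'[OF univoque_shift[OF A, of n]] by auto
    qed
  qed
  then show ?thesis by (rule below_tm_imp_ev_periodic)
qed

end

section \<open>Two eventually periodic expansions\<close>

lemma ev_periodic_add:
  fixes A :: "nat \<Rightarrow> bool"
  assumes "ev_periodic (\<lambda>i. A (n + i))"
  shows "ev_periodic A"
proof -
  obtain s r where sr: "s > 0" "\<And>i. i \<ge> r \<Longrightarrow> A (n + (i + s)) = A (n + i)"
    using assms unfolding ev_periodic_def by blast
  show ?thesis
  proof (rule ev_periodicI[of s "n + r"])
    fix i assume "n + r \<le> i"
    then show "A (i + s) = A i" using sr(2)[of "i - n"] by (simp add: algebra_simps)
  qed (rule sr(1))
qed

lemma ev_periodic_multiple:
  fixes A :: "nat \<Rightarrow> 'a"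
  assumes "\<And>n. n \<ge> r \<Longrightarrow> A (n + s) = A n" "n \<ge> r"
  shows "A (n + m * s) = A n"
proof (induction m)
  case (Suc m)
  then show ?case using assms(1)[of "n + m * s"] assms(2) by (simp add: algebra_simps)
qed simp

text \<open>Multiplying the difference series by \<open>1 - x ^ s\<close>, with \<open>s\<close> a
  common period, cuts it down to a polynomial with integer coefficients that vanishes at
  \<open>x\<close>.\<close>

lemma algebraic_of_periodic_expansions:
  assumes x: "0 < x" "x < 1" and A: "ev_periodic A" and B: "ev_periodic B"
    and eq: "digit_sum x A = digit_sum x B" and ne: "A \<noteq> B"
  shows "algebraic x"
proof -
  obtain s1 r1 where A: "s1 > 0" "\<And>n. n \<ge> r1 \<Longrightarrow> A (n + s1) = A n"
    using A unfolding ev_periodic_def by blast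
  obtain s2 r2 where B: "s2 > 0" "\<And>n. n \<ge> r2 \<Longrightarrow> B (n + s2) = B n"
    using B unfolding ev_periodic_def by blast
  define s where "s = s1 * s2"
  define r where "r = max r1 r2"
  define d :: "nat \<Rightarrow> real" where "d n = of_bool (A n) - of_bool (B n)" for n
  have s: "s > 0" using A B by (simp add: s_def)
  have per: "d (n + s) = d n" if "n \<ge> r" for n
    using ev_periodic_multiple[of r1 A s1 n s2, OF A(2)]
      ev_periodic_multiple[of r2 B s2 n s1, OF B(2)] that
    unfolding d_def s_def r_def by (simp add: algebra_simps)
  have sums0: "(\<lambda>n. d n * x ^ n) sums 0"
    using sums_diff[OF digit_sum_sums[OF x, of A] digit_sum_sums[OF x, of B]] eq
    unfolding d_def by (simp add: algebra_simps)
  \<comment> \<open>Coefficients of that product; from \<open>r + s\<close> on periodicity cancels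
    them.\<close>
  define c where "c n = d n - (if n \<ge> s then d (n - s) else 0)" for n
  have c0: "c n = 0" if "n \<ge> r + s" for n
    using per[of "n - s"] that unfolding c_def by simp
  have "(\<lambda>n. d n * x ^ n - (if n \<ge> s then d (n - s) else 0) * x ^ n) sums (0 - 0)"
  proof (rule sums_diff[OF sums0])
    have "(\<lambda>n. x ^ s * (d n * x ^ n)) sums (x ^ s * 0)" by (rule sums_mult[OF sums0])
    then have "(\<lambda>n. (if n + s \<ge> s then d (n + s - s) else 0) * x ^ (n + s)) sums 0"
      by (simp add: power_add ac_simps)
    then show "(\<lambda>n. (if n \<ge> s then d (n - s) else 0) * x ^ n) sums 0"
      using sums_iff_shift[of "\<lambda>n. (if n \<ge> s then d (n - s) else 0) * x ^ n" s 0] by simp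
  qed
  then have "(\<lambda>n. c n * x ^ n) sums 0" by (simp add: c_def algebra_simps)
  moreover have "(\<lambda>n. c n * x ^ n) sums (\<Sum>n<r + s. c n * x ^ n)"
    by (rule sums_finite) (use c0 in auto)
  ultimately have root: "(\<Sum>n<r + s. c n * x ^ n) = 0" using sums_unique2 by blast
  define P where "P = (\<Sum>n<r + s. monom (c n) n)"
  have coeff: "coeff P i = c i" for i
    using c0[of i] by (auto simp: P_def coeff_sum)
  have "\<exists>i. A i \<noteq> B i" using ne by auto
  then obtain j where j: "A j \<noteq> B j" "\<And>i. i < j \<Longrightarrow> A i = B i"
    using exists_least_iff[of "\<lambda>i. A i \<noteq> B i"] by blast
  \<comment> \<open>At the first difference \<open>j\<close> the shifted term is still zero, so the
    polynomial is nonzero.\<close>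
  have "c j = d j" using j(2)[of "j - s"] s by (auto simp: c_def d_def)
  then have "c j \<noteq> 0" using j(1) by (auto simp: d_def)
  then have "P \<noteq> 0" using coeff[of j] by auto
  moreover have "poly P x = 0" using root by (simp add: P_def poly_sum poly_monom)
  moreover have "coeff P i \<in> \<int>" for i unfolding coeff c_def d_def by auto
  ultimately show ?thesis by (intro algebraicI)
qed

section \<open>Perfect sets of sequences\<close>

text \<open>The space of digit sequences is compact Hausdorff with cylinders as neighbourhood base.
  There \<open>closed\<close> and \<open>no_isolated\<close> say that \<open>S\<close> is its own
  derived set, and a nonempty perfect set is at least as large as the reals.\<close>

lemma perfect_sequences_lepoll:
  fixes S :: "(nat \<Rightarrow> bool) set"
  assumes ne: "S \<noteq> {}"
    and closed: "\<And>A. (\<And>n. \<exists>B\<in>S. \<forall>i<n. B i = A i) \<Longrightarrow> A \<in> S"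
    and no_isolated: "\<And>A n. A \<in> S \<Longrightarrow> \<exists>B\<in>S. B \<noteq> A \<and> (\<forall>i<n. B i = A i)"
  shows "(UNIV :: real set) \<lesssim> S"
proof -
  define X :: "(nat \<Rightarrow> bool) topology" where
    "X = product_topology (\<lambda>_. discrete_topology UNIV) UNIV"
  have top: "topspace X = UNIV" unfolding X_def by simp
  have cyl: "openin X {B. \<forall>i<n. B i = A i}" for A n
  proof -
    have "openin X (Pi\<^sub>E UNIV (\<lambda>i. if i < n then {A i} else UNIV))"
      unfolding X_def by (rule iffD2[OF openin_PiE_gen]) auto
    also have "Pi\<^sub>E UNIV (\<lambda>i. if i < n then {A i} else UNIV) = {B. \<forall>i<n. B i = A i}"
      by (auto simp: PiE_iff split: if_splits)
    finally show ?thesis .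
  qed
  have nbhd: "\<exists>n. {B. \<forall>i<n. B i = A i} \<subseteq> T" if T: "openin X T" "A \<in> T" for A T
  proof -
    obtain U where U: "finite {i. U i \<noteq> UNIV}" "A \<in> Pi\<^sub>E UNIV U" "Pi\<^sub>E UNIV U \<subseteq> T"
      using T unfolding X_def openin_product_topology_alt by force
    obtain n where n: "\<And>i. U i \<noteq> UNIV \<Longrightarrow> i < n"
      using U(1) unfolding finite_nat_set_iff_bounded by blast
    have "{B. \<forall>i<n. B i = A i} \<subseteq> Pi\<^sub>E UNIV U"
    proof
      fix B assume B: "B \<in> {B. \<forall>i<n. B i = A i}"
      have "B i \<in> U i" for i
      proof (cases "U i = UNIV")
        case False
        then show ?thesis using n[of i] B U(2) by auto
      qed simp
      then show "B \<in> Pi\<^sub>E UNIV U" by auto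
    qed
    then have "{B. \<forall>i<n. B i = A i} \<subseteq> T" using U(3) by (rule subset_trans)
    then show ?thesis ..
  qed
  have "X derived_set_of S = S"
  proof (intro equalityI subsetI)
    fix A assume "A \<in> X derived_set_of S"
    then have lim: "\<exists>B. B \<noteq> A \<and> B \<in> S \<and> B \<in> T" if "A \<in> T" "openin X T" for T
      using that unfolding in_derived_set_of by blast
    show "A \<in> S"
    proof (rule closed)
      show "\<exists>B\<in>S. \<forall>i<n. B i = A i" for n using lim[OF _ cyl[of n A]] by auto
    qed
  next
    fix A assume A: "A \<in> S"
    have "\<exists>B. B \<noteq> A \<and> B \<in> S \<and> B \<in> T" if T: "A \<in> T" "openin X T" for T
    proof -
      obtain n where n: "{B. \<forall>i<n. B i = A i} \<subseteq> T" using nbhd[OF T(2,1)] by (rule exE)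
      obtain B where "B \<in> S" "B \<noteq> A" "\<forall>i<n. B i = A i" using no_isolated[OF A, of n] by blast
      then show ?thesis using n by auto
    qed
    then show "A \<in> X derived_set_of S" unfolding in_derived_set_of top by simp
  qed
  moreover have "locally_compact_space X" "Hausdorff_space X"
    unfolding X_def
    by (auto simp: Hausdorff_space_product_topology compact_space_product_topology
        compact_space_discrete_topology intro!: compact_imp_locally_compact_space)
  ultimately show ?thesis using ne by (intro lepoll_perfect_set[of X S]) simp_all
qed

section \<open>The dichotomy\<close>

text \<open>Continuity: sums of sequences sharing \<open>n\<close> digits are within
  \<open>x ^ n / (1 - x)\<close> of each other.\<close>

lemma digit_sum_level_closed:
  assumes x: "0 < x" "x < 1"
    and approx: "\<And>n. \<exists>B. digit_sum x B = y \<and> (\<forall>i<n. B i = A i)"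
  shows "digit_sum x A = y"
proof -
  have "\<bar>digit_sum x A - y\<bar> \<le> x ^ n * (1 / (1 - x))" for n
  proof -
    obtain B where B: "digit_sum x B = y" "\<And>i. i < n \<Longrightarrow> B i = A i" using approx by blast
    have "(\<Sum>i<n. of_bool (B i) * x ^ i) = (\<Sum>i<n. of_bool (A i) * x ^ i)"
      using B(2) by (intro sum.cong) auto
    then have eq: "digit_sum x A - y =
        x ^ n * (digit_sum x (\<lambda>i. A (n + i)) - digit_sum x (\<lambda>i. B (n + i)))"
      using digit_sum_split[OF x, of A n] digit_sum_split[OF x, of B n] B(1)
      by (simp add: algebra_simps)
    have "\<bar>digit_sum x (\<lambda>i. A (n + i)) - digit_sum x (\<lambda>i. B (n + i))\<bar> \<le> 1 / (1 - x)"
      using digit_sum_nonneg[OF x] digit_sum_le[OF x] by (smt (verit))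
    then show ?thesis unfolding eq abs_mult using x by (intro mult_mono) auto
  qed
  moreover have "(\<lambda>n. x ^ n * (1 / (1 - x))) \<longlonglongrightarrow> 0"
    by (intro tendsto_mult_left_zero LIMSEQ_realpow_zero) (use x in auto)
  ultimately have "\<bar>digit_sum x A - y\<bar> \<le> 0" by (intro LIMSEQ_le_const) auto
  then show ?thesis by simp
qed

lemma digit_sum_level_continuum:
  assumes x: "1 / 2 \<le> x" "x < 1" "1 / komornik_loreti < x" and trans: "\<not> algebraic x"
    and AB: "digit_sum x A = y" "digit_sum x B = y" "A \<noteq> B"
  shows "(UNIV :: real set) \<lesssim> {D. digit_sum x D = y}"
proof -
  have x0: "0 < x" "x < 1" using x by auto
  define E where "E = {D. digit_sum x D = y}"
  define isolated where "isolated C \<longleftrightarrow>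
    C \<in> E \<and> (\<exists>n. \<forall>D\<in>E. (\<forall>i<n. D i = C i) \<longrightarrow> D = C)" for C
  have per: "ev_periodic C" if iso: "isolated C" for C
  proof -
    obtain n where C: "C \<in> E" and n: "\<And>D. D \<in> E \<Longrightarrow> (\<And>i. i < n \<Longrightarrow> D i = C i) \<Longrightarrow> D = C"
      using iso unfolding isolated_def by blast
    \<comment> \<open>Another expansion \<open>F\<close> of the tail, glued to the first
      \<open>n\<close> digits of \<open>C\<close>, would contradict isolation.\<close>
    have "univoque x (\<lambda>i. C (n + i))"
      unfolding univoque_def
    proof (intro allI impI)
      fix F assume F: "digit_sum x F = digit_sum x (\<lambda>i. C (n + i))"
      define D where "D i = (if i < n then C i else F (i - n))" for i
      have "digit_sum x D = digit_sum x C"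
        using digit_sum_split[OF x0, of D n] digit_sum_split[OF x0, of C n] F
        by (simp add: D_def)
      then have "D = C" using C by (intro n) (auto simp: E_def D_def)
      then have "D (n + i) = C (n + i)" for i by simp
      then show "F = (\<lambda>i. C (n + i))" unfolding D_def by auto
    qed
    then have "ev_periodic (\<lambda>i. C (n + i))" by (rule univoque_imp_ev_periodic[OF x(1,2) _ x(3)])
    then show ?thesis by (rule ev_periodic_add)
  qed
  have iso_unique: "C = D" if "isolated C" "isolated D" for C D
    using algebraic_of_periodic_expansions[OF x0 per[OF that(1)] per[OF that(2)]] trans that
    unfolding isolated_def E_def by auto
  \<comment> \<open>Position \<open>j\<close> cuts \<open>E\<close> into two nonempty cylinders. At
    most one of them contains an isolated point; \<open>F\<close> is taken from one without.\<close>
  obtain j where j: "A j \<noteq> B j" using AB(3) by auto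
  obtain F where F: "F \<in> E" "\<And>C. isolated C \<Longrightarrow> C j \<noteq> F j"
  proof (cases "\<exists>C. isolated C \<and> C j = A j")
    case True
    then obtain C where C: "isolated C" "C j = A j" by blast
    show ?thesis
    proof (rule that[of B])
      show "B \<in> E" using AB(2) unfolding E_def by simp
    next
      fix D assume "isolated D"
      then have "C = D" by (rule iso_unique[OF C(1)])
      then show "D j \<noteq> B j" using C(2) j by blast
    qed
  next
    case False
    have "A \<in> E" using AB(1) unfolding E_def by simp
    then show ?thesis by (rule that) (use False in blast)
  qed
  define S where "S = {D \<in> E. D j = F j}"
  have "(UNIV :: real set) \<lesssim> S"
  proof (rule perfect_sequences_lepoll)
    show "S \<noteq> {}" using F(1) unfolding S_def by auto
  next
    fix D assume D: "\<And>n. \<exists>C\<in>S. \<forall>i<n. C i = D i"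
    have "digit_sum x D = y"
      by (rule digit_sum_level_closed[OF x0]) (use D in \<open>auto simp: S_def E_def\<close>)
    moreover have "D j = F j" using D[of "Suc j"] unfolding S_def by auto
    ultimately show "D \<in> S" unfolding S_def E_def by simp
  next
    fix D n assume D: "D \<in> S"
    then have "\<not> isolated D" using F(2) unfolding S_def by auto
    \<comment> \<open>The common prefix includes position \<open>j\<close>, so that \<open>C\<close>
      stays in the cylinder.\<close>
    then obtain C where C: "C \<in> E" "C \<noteq> D" "\<And>i. i < max n (Suc j) \<Longrightarrow> C i = D i"
      using D unfolding isolated_def S_def by blast
    then have "C \<in> S" using D unfolding S_def by simp
    then show "\<exists>C\<in>S. C \<noteq> D \<and> (\<forall>i<n. C i = D i)" using C by auto
  qed
  also have "S \<lesssim> E" by (rule subset_imp_lepoll) (auto simp: S_def)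
  finally show ?thesis unfolding E_def .
qed

text \<open>\<open>digit_sum\<close> starts with weight 1 instead of \<open>1 / q\<close>, hence the
  factor \<open>q\<close>.\<close>

lemma bij_betw_expansions:
  assumes q: "q > 1"
  shows "bij_betw (\<lambda>A n. of_bool (A n)) {A. digit_sum (1 / q) A = q * x} (expansions q x)"
proof -
  have x: "0 < 1 / q" "1 / q < 1" using q by auto
  have iff: "(\<lambda>n. of_bool (A n)) \<in> expansions q x \<longleftrightarrow> digit_sum (1 / q) A = q * x" for A
  proof -
    have "(\<lambda>n. of_bool (A n) * (1 / q) ^ n) sums digit_sum (1 / q) A"
      by (rule digit_sum_sums[OF x])
    from sums_mult[OF this, of "1 / q"]
    have "(\<lambda>n. of_bool (A n) / q ^ Suc n) sums (digit_sum (1 / q) A / q)"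
      by (simp add: power_one_over)
    then have "(\<lambda>n. of_bool (A n) / q ^ Suc n) sums x \<longleftrightarrow> digit_sum (1 / q) A / q = x"
      by (metis sums_unique2)
    then show ?thesis using q by (auto simp: expansions_def field_simps)
  qed
  have surj: "a \<in> (\<lambda>A n. of_bool (A n)) ` {A. digit_sum (1 / q) A = q * x}"
    if a: "a \<in> expansions q x" for a
  proof -
    have "range a \<subseteq> {0, 1}" using a unfolding expansions_def by simp
    then have "a n \<in> {0, 1}" for n by blast
    then have "a = (\<lambda>n. of_bool (a n = 1))" by force
    then show ?thesis using iff[of "\<lambda>n. a n = 1"] a by auto
  qed
  show ?thesis
  proof (rule bij_betw_imageI)
    show "inj_on (\<lambda>A n. of_bool (A n)) {A. digit_sum (1 / q) A = q * x}"
      by (rule inj_onI) (auto simp: fun_eq_iff of_bool_eq_iff)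
    show "(\<lambda>A n. of_bool (A n)) ` {A. digit_sum (1 / q) A = q * x} = expansions q x"
      using iff surj by blast
  qed
qed

theorem theorem2p1:
  fixes q :: real
  assumes "\<not> algebraic q"
    and "(1 + sqrt 5) / 2 < q" and "q < komornik_loreti"
  shows "\<forall>x\<in>{0..1 / (q - 1)}.
    (\<exists>!a. a \<in> expansions q x) \<or> expansions q x \<approx> (UNIV :: nat set set)"
proof
  fix x assume x: "x \<in> {0..1 / (q - 1)}"
  have "1 < sqrt 5" by simp
  then have "1 < (1 + sqrt 5) / 2" using less_half_sum[of 1 "sqrt 5"] by (simp only: one_add_one)
  then have q1: "q > 1" using assms(2) by (rule less_trans)
  define z where "z = 1 / q"
  have z0: "0 < z" "z < 1" using q1 unfolding z_def by auto
  have zp: "1 / komornik_loreti < z"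
    using assms(3) q1 unfolding z_def by (simp add: frac_less2)
  \<comment> \<open>The digits of \<open>tm\<close> after the leading 0 weigh 1, but at most
    \<open>w / (1 - w)\<close>. The result provides \<open>1 / 2 \<le> z\<close>, the condition for
    expansions to exist.\<close>
  have "komornik_loreti \<le> 2"
  proof -
    define w where "w = 1 / komornik_loreti"
    have w: "0 < w" "w < 1" using digit_sum_komornik_loreti(1) unfolding w_def by auto
    have "1 \<le> w * digit_sum w (\<lambda>i. tm (Suc i))"
      using digit_sum_Suc[OF w, of tm] digit_sum_komornik_loreti(2) tm_values(1)
      unfolding w_def by simp
    also have "\<dots> \<le> w * (1 / (1 - w))"
      using w by (intro mult_left_mono digit_sum_le) auto
    finally have "1 / 2 \<le> w" using w by (simp add: field_simps)
    then show ?thesis using digit_sum_komornik_loreti(1) unfolding w_def by (simp add: field_simps)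
  qed
  then have z2: "1 / 2 \<le> z" using assms(3) q1 unfolding z_def by (simp add: field_simps)
  have trans: "\<not> algebraic z"
    using assms(1) algebraic_inverse[of z] unfolding z_def by auto
  define E where "E = {A. digit_sum z A = q * x}"
  have bij: "bij_betw (\<lambda>A n. of_bool (A n)) E (expansions q x)"
    unfolding E_def z_def by (rule bij_betw_expansions[OF q1])
  have "q * x \<le> q * (1 / (q - 1))" using x q1 by (intro mult_left_mono) auto
  also have "\<dots> = 1 / (1 - z)" using q1 unfolding z_def by (simp add: field_simps)
  finally obtain A where A: "A \<in> E"
    using exists_digits[OF z0 z2, of "q * x"] x q1 unfolding E_def by auto
  show "(\<exists>!a. a \<in> expansions q x) \<or> expansions q x \<approx> (UNIV :: nat set set)"
  proof (cases "E = {A}")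
    case True
    then have "expansions q x = {\<lambda>n. of_bool (A n)}" using bij unfolding bij_betw_def by auto
    then show ?thesis by auto
  next
    case False
    then obtain B where B: "B \<in> E" "A \<noteq> B" using A by auto
    \<comment> \<open>Schroeder-Bernstein: two distinct elements of \<open>E\<close> give the lower
      bound, and \<open>E\<close>, consisting of predicates on the naturals, embeds in the power
      set.\<close>
    have "(UNIV :: nat set set) \<lesssim> E"
      using lepoll_trans1[OF nat_sets_eqpoll_reals]
        digit_sum_level_continuum[OF z2 z0(2) zp trans] A B unfolding E_def by blast
    moreover have "E \<lesssim> (UNIV :: nat set set)"
      unfolding lepoll_def by (intro exI[of _ Collect] conjI inj_onI subset_UNIV) (rule Collect_inj)
    moreover have "E \<approx> expansions q x" using bij unfolding eqpoll_def by blast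
    ultimately show ?thesis by (meson eqpoll_sym eqpoll_trans lepoll_antisym)
  qed
qed

end
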